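(* Let $k$ and $p$ be integers with $k\ge 2$ and $p\ge 0$. Let $a_1,a_2,\dots,a_k$ be positive integers with $\gcd(a_1,a_2,\dots,a_k)=1$ and $a_1=\min_{1\le i\le k}a_i$, and let $\{m_0^{(p)},m_1^{(p)},\dots,m_{a_1-1}^{(p)}\}$ be the $p$-Apéry set of $\{a_1,\dots,a_k\}$. Then \begin{align*} g_p(a_1,a_2,\dots,a_k)&=\max_{0\le i\le a_1-1}m_i^{(p)}-a_1,\\ n_p(a_1,a_2,\dots,a_k)&=\frac{1}{a_1}\sum_{i=0}^{a_1-1}m_i^{(p)}-\frac{a_1-1}{2},\\ s_p(a_1,a_2,\dots,a_k)&=\frac{1}{2a_1}\sum_{i=0}^{a_1-1}\bigl(m_i^{(p)}\bigr)^2-\frac12\sum_{i=0}^{a_1-1}m_i^{(p)}+\frac{a_1^2-1}{12}. \end{align*}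
   Context: $\mathbb N_0$ denotes the set of non-negative integers. For positive integers $a_1,\dots,a_k$ and $n\in\mathbb N_0$, the denumerant is $$d(n)=d(n;a_1,\dots,a_k)=\#\{(x_1,\dots,x_k)\in\mathbb N_0^k : n=x_1a_1+\cdots+x_ka_k\}.$$ For an integer $p\ge 0$ put $S_p=S_p(a_1,\dots,a_k)=\{n\in\mathbb N_0 : d(n)>p\}$. The $p$-Frobenius number, $p$-Sylvester number ($p$-genus) and $p$-Sylvester sum are $$g_p=\max_{n\in\mathbb N_0\setminus S_p}n,\qquad n_p=\sum_{n\in\mathbb N_0\setminus S_p}1,\qquad s_p=\sum_{n\in\mathbb N_0\setminus S_p}n .$$ In the degenerate case $\mathbb N_0\setminus S_p=\emptyset$ (which occurs only when $p=0$ and $a_1=1$), $g_p$ is understood as $-1$, i.e. the largest integer (negative integers having no representation) with at most $p$ representations. The $p$-Apéry set of $\{a_1,\dots,a_k\}$ is $\{m_0^{(p)},m_1^{(p)},\dots,m_{a_1-1}^{(p)}\}$, where for $0\le i\le a_1-1$ the non-negative integer $m_i^{(p)}$ is uniquely determined by: (1) $m_i^{(p)}\equiv i\pmod{a_1}$; (2) $m_i^{(p)}\in S_p$; (3) $m_i^{(p)}-a_1\notin S_p$. *)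

theory Defs
  imports Complex_Main "HOL-Library.FuncSet"
begin

text \<open>
  The generators are the values \<open>a 1, \<dots>, a k\<close> (not necessarily distinct); \<open>a\<close> is irrelevant
  outside \<open>{1..k}\<close>. Coefficient vectors are extensional functions on \<open>{1..k}\<close>, so each vector is
  counted exactly once.
\<close>

definition denumerant :: "nat \<Rightarrow> (nat \<Rightarrow> nat) \<Rightarrow> nat \<Rightarrow> nat" where
  "denumerant k a n = card {x \<in> {1..k} \<rightarrow>\<^sub>E (UNIV :: nat set). n = (\<Sum>i = 1..k. x i * a i)}"

definition p_representable :: "nat \<Rightarrow> (nat \<Rightarrow> nat) \<Rightarrow> nat \<Rightarrow> nat set" where
  "p_representable k a p = {n. denumerant k a n > p}"

definition p_gaps :: "nat \<Rightarrow> (nat \<Rightarrow> nat) \<Rightarrow> nat \<Rightarrow> nat set" where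
  "p_gaps k a p = UNIV - p_representable k a p"

definition p_frobenius :: "nat \<Rightarrow> (nat \<Rightarrow> nat) \<Rightarrow> nat \<Rightarrow> int" where
  "p_frobenius k a p = (if p_gaps k a p = {} then - 1 else int (Max (p_gaps k a p)))"

definition p_sylvester_number :: "nat \<Rightarrow> (nat \<Rightarrow> nat) \<Rightarrow> nat \<Rightarrow> nat" where
  "p_sylvester_number k a p = (\<Sum>n \<in> p_gaps k a p. 1)"

definition p_sylvester_sum :: "nat \<Rightarrow> (nat \<Rightarrow> nat) \<Rightarrow> nat \<Rightarrow> nat" where
  "p_sylvester_sum k a p = (\<Sum>n \<in> p_gaps k a p. n)"

text \<open>
  The third condition is stated over the integers because \<open>m - a 1\<close> may be negative, in which
  case it is not an element of the set.
\<close>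

definition p_apery :: "nat \<Rightarrow> (nat \<Rightarrow> nat) \<Rightarrow> nat \<Rightarrow> nat \<Rightarrow> nat" where
  "p_apery k a p i = (THE m. m mod a 1 = i mod a 1 \<and> m \<in> p_representable k a p \<and>
                             int m - int (a 1) \<notin> int ` p_representable k a p)"

end

theory Submission
  imports Defs
begin

text \<open>
  Write \<open>A = a 1\<close>. Adding one more copy of \<open>a 1\<close> turns representations of \<open>n\<close> injectively into
  representations of \<open>n + A\<close>, so inside a residue class \<open>i + A * t\<close> the \<open>p\<close>-representable
  numbers form a final segment \<open>t \<ge> q i\<close> (\<open>denumerant_add_generator\<close>). It is nonempty: since
  the generators have greatest common divisor 1, Bezout gives some representable number in the
  class, and adding \<open>p * a 1 * a 2\<close> creates \<open>p + 1\<close> different representations, as every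
  \<open>a 1\<close> copies of \<open>a 2\<close> may be traded for \<open>a 2\<close> copies of \<open>a 1\<close>
  (\<open>ex_denumerant_gt_in_residue_class\<close>). Thus the Apery element of the class is \<open>i + A * q i\<close>, and
  the gaps are exactly the numbers \<open>i + A * t\<close> with \<open>i < A\<close> and \<open>t < q i\<close>.

  All three formulas hold for any thresholds \<open>q\<close>: the largest gap of a class lies \<open>A\<close> below its
  Apery element, and the two sums are evaluated class by class as arithmetic progressions, using
  \<open>q i = (m - i) / A\<close> where \<open>m\<close> is the Apery element.
\<close>

section \<open>Sets given by a threshold in each residue class\<close>

definition below_thresholds :: "nat \<Rightarrow> (nat \<Rightarrow> nat) \<Rightarrow> nat set" where
  "below_thresholds A q = {n. n div A < q (n mod A)}"

text \<open>
  Division with remainder is a bijection from the numbers below the thresholds onto the pairs of a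
  residue and an admissible quotient, so sums may be taken class by class.
\<close>

lemma sum_below_thresholds:
  assumes "A > 0"
  shows "(\<Sum>n\<in>below_thresholds A q. f n) = (\<Sum>i<A. \<Sum>t<q i. f (i + A * t))"
proof -
  have "(\<Sum>i<A. \<Sum>t<q i. f (i + A * t)) =
        (\<Sum>(i, t)\<in>(SIGMA i:{..<A}. {..<q i}). f (i + A * t))"
    by (simp add: sum.Sigma)
  also have "\<dots> = (\<Sum>n\<in>below_thresholds A q. f n)"
    by (rule sum.reindex_bij_witness[where j = "\<lambda>(i, t). i + A * t" and
          i = "\<lambda>n. (n mod A, n div A)"])
       (use assms in \<open>auto simp: below_thresholds_def\<close>)
  finally show ?thesis ..
qed

lemma finite_below_thresholds:
  assumes "A > 0"
  shows "finite (below_thresholds A q)"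
proof -
  have "below_thresholds A q \<subseteq> (\<lambda>(i, t). i + A * t) ` (SIGMA i:{..<A}. {..<q i})"
  proof
    fix n
    assume "n \<in> below_thresholds A q"
    then have "(n mod A, n div A) \<in> (SIGMA i:{..<A}. {..<q i})"
      using assms by (simp add: below_thresholds_def)
    moreover have "n = (\<lambda>(i, t). i + A * t) (n mod A, n div A)"
      by simp
    ultimately show "n \<in> (\<lambda>(i, t). i + A * t) ` (SIGMA i:{..<A}. {..<q i})"
      by blast
  qed
  then show ?thesis
    by (rule finite_subset) auto
qed

lemma Max_below_thresholds:
  assumes "A > 0"
  shows "(if below_thresholds A q = {} then - 1 else int (Max (below_thresholds A q))) =
         int (Max ((\<lambda>i. i + A * q i) ` {..<A})) - int A"
proof -
  define M where "M = Max ((\<lambda>i. i + A * q i) ` {..<A})"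
  have M_ge: "i + A * q i \<le> M" if "i < A" for i
    unfolding M_def using that by (intro Max_ge) auto
  have "M \<in> (\<lambda>i. i + A * q i) ` {..<A}"
    unfolding M_def using assms by (intro Max_in) auto
  then obtain j where j: "j < A" "M = j + A * q j"
    by auto
  have upper: "n + A \<le> M" if "n \<in> below_thresholds A q" for n
  proof -
    have "A * Suc (n div A) \<le> A * q (n mod A)"
      using that by (intro mult_left_mono) (auto simp: below_thresholds_def)
    then have "n mod A + A * Suc (n div A) \<le> M"
      using M_ge[of "n mod A"] assms by (meson add_left_mono mod_less_divisor order_trans)
    then show ?thesis
      by simp
  qed
  show ?thesis
  proof (cases "q j = 0")
    case True
    \<comment> \<open>Here all thresholds vanish, and the maximum is the largest residue \<open>A - 1\<close>.\<close>
    then have "M < A"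
      using j by simp
    then have "below_thresholds A q = {}"
      using upper by force
    moreover have "A - 1 \<le> M"
      using M_ge[of "A - 1"] assms by simp
    ultimately show ?thesis
      using \<open>M < A\<close> by (simp add: M_def[symmetric])
  next
    case False
    then obtain r where r: "q j = Suc r"
      using not0_implies_Suc by blast
    have in_set: "j + A * r \<in> below_thresholds A q"
      using j r by (simp add: below_thresholds_def)
    have "M = (j + A * r) + A"
      using j r by simp
    then have "Max (below_thresholds A q) = j + A * r"
      using upper in_set finite_below_thresholds[OF assms] by (intro Max_eqI) force+
    then show ?thesis
      using in_set \<open>M = (j + A * r) + A\<close> by (auto simp: M_def[symmetric])
  qed
qed

lemma sum_residues: "(\<Sum>i<A. real i) = real A * (real A - 1) / 2"
  by (induction A) (auto simp: field_simps)

lemma sum_residues_square: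
  "(\<Sum>i<A. (real i)\<^sup>2) = real A * (real A - 1) * (2 * real A - 1) / 6"
  by (induction A) (auto simp: field_simps power2_eq_square)

lemma card_below_thresholds:
  assumes "A > 0"
  shows "real (card (below_thresholds A q)) =
         1 / real A * (\<Sum>i<A. real (i + A * q i)) - (real A - 1) / 2"
proof -
  have "card (below_thresholds A q) = (\<Sum>i<A. q i)"
    using sum_below_thresholds[OF assms, of "\<lambda>_. 1::nat" q] by simp
  moreover have "(\<Sum>i<A. real (i + A * q i)) =
      real A * (real A - 1) / 2 + real A * (\<Sum>i<A. real (q i))"
    by (simp add: sum.distrib sum_residues sum_distrib_left)
  ultimately show ?thesis
    using assms by (simp add: field_simps)
qed

text \<open>
  Each class contributes an arithmetic progression whose sum is a quadratic polynomial in the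
  number \<open>m = i + A * q i\<close>; the remaining terms \<open>i / 2 - i\<^sup>2 / (2 * A)\<close> depend on the
  residue only and add up to \<open>(A\<^sup>2 - 1) / 12\<close>.
\<close>

lemma sum_below_thresholds_id:
  assumes "A > 0"
  shows "real (\<Sum>(below_thresholds A q)) =
         1 / (2 * real A) * (\<Sum>i<A. (real (i + A * q i))\<^sup>2)
         - 1 / 2 * (\<Sum>i<A. real (i + A * q i)) + ((real A)\<^sup>2 - 1) / 12"
proof -
  have progression: "(\<Sum>t<r. real (i + A * t)) =
      1 / (2 * real A) * (real (i + A * r))\<^sup>2 - 1 / 2 * real (i + A * r)
      + (1 / 2 * real i - 1 / (2 * real A) * (real i)\<^sup>2)" for i r
    using assms by (induction r) (auto simp: field_simps power2_eq_square)
  have "real (\<Sum>(below_thresholds A q)) = (\<Sum>i<A. \<Sum>t<q i. real (i + A * t))"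
    using sum_below_thresholds[OF assms, of real q] by simp
  also have "\<dots> = 1 / (2 * real A) * (\<Sum>i<A. (real (i + A * q i))\<^sup>2)
      - 1 / 2 * (\<Sum>i<A. real (i + A * q i))
      + (1 / 2 * (\<Sum>i<A. real i) - 1 / (2 * real A) * (\<Sum>i<A. (real i)\<^sup>2))"
    unfolding progression sum.distrib sum_subtractf sum_distrib_left ..
  also have "1 / 2 * (\<Sum>i<A. real i) - 1 / (2 * real A) * (\<Sum>i<A. (real i)\<^sup>2)
      = ((real A)\<^sup>2 - 1) / 12"
    unfolding sum_residues sum_residues_square
    using assms by (simp add: field_simps power2_eq_square)
  finally show ?thesis .
qed

section \<open>The number of representations along a residue class\<close>

definition representations :: "nat \<Rightarrow> (nat \<Rightarrow> nat) \<Rightarrow> nat \<Rightarrow> (nat \<Rightarrow> nat) set" where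
  "representations k a n = {x \<in> {1..k} \<rightarrow>\<^sub>E UNIV. n = (\<Sum>i = 1..k. x i * a i)}"

lemma denumerant_eq_card: "denumerant k a n = card (representations k a n)"
  by (simp add: denumerant_def representations_def)

lemma finite_representations:
  assumes "\<And>i. i \<in> {1..k} \<Longrightarrow> a i > 0"
  shows "finite (representations k a n)"
proof (rule finite_subset)
  show "representations k a n \<subseteq> {1..k} \<rightarrow>\<^sub>E {..n}"
  proof
    fix x
    assume x: "x \<in> representations k a n"
    have "x i \<le> n" if "i \<in> {1..k}" for i
    proof -
      have "x i * 1 \<le> x i * a i"
        using assms[OF that] by (intro mult_left_mono) auto
      also have "\<dots> \<le> (\<Sum>i = 1..k. x i * a i)"
        using that by (intro member_le_sum) auto
      finally show ?thesis
        using x by (simp add: representations_def)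
    qed
    then show "x \<in> {1..k} \<rightarrow>\<^sub>E {..n}"
      using x by (auto simp: representations_def PiE_iff)
  qed
qed (auto intro: finite_PiE)

lemma representation_add:
  assumes "x \<in> representations k a n" and "j \<in> {1..k}"
  shows "x(j := x j + c) \<in> representations k a (n + c * a j)"
proof -
  have "(\<Sum>i = 1..k. (x(j := x j + c)) i * a i) =
        (\<Sum>i = 1..k. x i * a i + (if i = j then c * a j else 0))"
    by (rule sum.cong) (auto simp: algebra_simps)
  also have "\<dots> = n + c * a j"
    using assms by (simp add: sum.distrib representations_def)
  finally show ?thesis
    using assms by (auto simp: representations_def PiE_iff extensional_def)
qed

lemma denumerant_add_generator:
  assumes "\<And>i. i \<in> {1..k} \<Longrightarrow> a i > 0" and "j \<in> {1..k}"
  shows "denumerant k a n \<le> denumerant k a (n + c * a j)"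
  unfolding denumerant_eq_card
proof (rule card_inj_on_le)
  show "inj_on (\<lambda>x. x(j := x j + c)) (representations k a n)"
  proof (rule inj_onI)
    fix x y :: "nat \<Rightarrow> nat"
    assume eq: "x(j := x j + c) = y(j := y j + c)"
    have "x i = y i" for i
      using fun_cong[OF eq, of i] by (cases "i = j") auto
    then show "x = y" ..
  qed
  show "(\<lambda>x. x(j := x j + c)) ` representations k a n \<subseteq> representations k a (n + c * a j)"
    using representation_add[OF _ assms(2)] by blast
qed (rule finite_representations[OF assms(1)])

lemma bezout_finite_set:
  assumes "finite I"
  shows "\<exists>u :: 'a \<Rightarrow> int. (\<Sum>i\<in>I. u i * int (a i)) = int (Gcd (a ` I))"
  using assms
proof (induction I)
  case empty
  then show ?case by simp
next
  case (insert j I)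
  then obtain u where u: "(\<Sum>i\<in>I. u i * int (a i)) = int (Gcd (a ` I))"
    by blast
  obtain v w where vw: "v * int (a j) + w * int (Gcd (a ` I)) = gcd (int (a j)) (int (Gcd (a ` I)))"
    using bezout_int by blast
  have "(\<Sum>i\<in>insert j I. (if i = j then v else w * u i) * int (a i)) =
        v * int (a j) + (\<Sum>i\<in>I. w * (u i * int (a i)))"
    using insert by (auto intro!: sum.cong)
  also have "\<dots> = int (Gcd (a ` insert j I))"
    using vw by (simp add: u flip: sum_distrib_left)
  finally show ?case
    by (rule exI[of _ "\<lambda>i. if i = j then v else w * u i"])
qed

text \<open>
  Scaling a Bezout combination by \<open>i\<close> gives the residue class of \<open>i\<close>.
  Reducing the scaled coefficients modulo \<open>A\<close> makes them nonnegative and does not change the residue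
  class of the combination.
\<close>

lemma ex_representation_in_residue_class:
  assumes "A > 0" and "Gcd (a ` {1..k}) = 1"
  shows "\<exists>n. n mod A = i mod A \<and> representations k a n \<noteq> {}"
proof -
  obtain u :: "nat \<Rightarrow> int" where u: "(\<Sum>j = 1..k. u j * int (a j)) = 1"
    using bezout_finite_set[of "{1..k}" a] assms(2) by auto
  define x where "x = (\<lambda>j\<in>{1..k}. nat (int i * u j mod int A))"
  define n where "n = (\<Sum>j = 1..k. x j * a j)"
  have "int n = (\<Sum>j = 1..k. (int i * u j mod int A) * int (a j))"
    unfolding n_def x_def using assms(1) by simp
  then have "int n mod int A = (\<Sum>j = 1..k. (int i * u j mod int A) * int (a j) mod int A) mod int A"
    by (simp add: mod_sum_eq)
  also have "\<dots> = (\<Sum>j = 1..k. int i * (u j * int (a j))) mod int A"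
    by (simp add: mod_simps mod_sum_eq mult.assoc)
  also have "\<dots> = int i mod int A"
    using u by (simp flip: sum_distrib_left)
  finally have "n mod A = i mod A"
    by (simp flip: of_nat_mod)
  moreover have "x \<in> representations k a n"
    by (simp add: representations_def n_def x_def)
  ultimately show ?thesis
    by blast
qed

lemma ex_denumerant_gt_in_residue_class:
  assumes "k \<ge> 2" and pos: "\<And>i. i \<in> {1..k} \<Longrightarrow> a i > 0" and "Gcd (a ` {1..k}) = 1"
  shows "\<exists>n. n mod a 1 = i mod a 1 \<and> denumerant k a n > p"
proof -
  have ends: "1 \<in> {1..k}" "2 \<in> {1..k}"
    using assms(1) by auto
  obtain n x where n: "n mod a 1 = i mod a 1" and x: "x \<in> representations k a n"
    using ex_representation_in_residue_class[OF pos[OF ends(1)] assms(3)] by blast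
  \<comment> \<open>Of \<open>p\<close> blocks worth \<open>a 1 * a 2\<close> each, \<open>j\<close> are paid in copies of \<open>a 2\<close> and \<open>p - j\<close> in copies
    of \<open>a 1\<close>; the coordinate at 2 recovers \<open>j\<close>.\<close>
  define y where "y = (\<lambda>j. (x(1 := x 1 + (p - j) * a 2))(2 := x 2 + j * a 1))"
  have "y j \<in> representations k a (n + p * a 2 * a 1)" if "j \<le> p" for j
  proof -
    have "y j \<in> representations k a (n + (p - j) * a 2 * a 1 + j * a 1 * a 2)"
      using representation_add[OF representation_add[OF x ends(1)] ends(2), of "(p - j) * a 2" "j * a 1"]
      by (simp add: y_def)
    moreover have "(p - j) * a 2 * a 1 + j * a 1 * a 2 = (p - j + j) * a 2 * a 1"
      by (simp only: algebra_simps)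
    ultimately show ?thesis
      using that by (simp add: add.assoc)
  qed
  moreover have "inj_on y {..p}"
  proof (rule inj_onI)
    fix j j'
    assume "y j = y j'"
    from fun_cong[OF this, of 2] show "j = j'"
      using pos[OF ends(1)] by (simp add: y_def)
  qed
  ultimately have "card {..p} \<le> card (representations k a (n + p * a 2 * a 1))"
    by (intro card_inj_on_le[of y] finite_representations pos) auto
  moreover have "(n + p * a 2 * a 1) mod a 1 = i mod a 1"
    using n by simp
  ultimately show ?thesis
    unfolding denumerant_eq_card by (metis card_atMost Suc_le_eq)
qed

section \<open>The Apery set as a set of thresholds\<close>

text \<open>
  The conditions \<open>m \<in> S\<close> and \<open>m - a 1 \<notin> S\<close> single out one number of a residue class only because
  membership in \<open>S\<close> is monotone along the class: they then mark the first element of the final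
  segment.
\<close>

lemma ex_thresholds:
  assumes "k \<ge> 2" and pos: "\<And>i. i \<in> {1..k} \<Longrightarrow> a i > 0" and "Gcd (a ` {1..k}) = 1"
  obtains q where "p_gaps k a p = below_thresholds (a 1) q"
    and "\<And>i. i < a 1 \<Longrightarrow> p_apery k a p i = i + a 1 * q i"
proof -
  let ?S = "p_representable k a p"
  define q where "q i = (LEAST t. i + a 1 * t \<in> ?S)" for i
  have one: "1 \<in> {1..k}"
    using assms(1) by simp
  have mem_iff: "i + a 1 * t \<in> ?S \<longleftrightarrow> q i \<le> t" if "i < a 1" for i t
  proof
    assume "q i \<le> t"
    obtain n where n: "n mod a 1 = i mod a 1" "denumerant k a n > p"
      using ex_denumerant_gt_in_residue_class[OF assms] by blast
    then have "i + a 1 * (n div a 1) \<in> ?S"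
      using that mod_mult_div_eq[of n "a 1"] by (simp add: p_representable_def)
    then have "i + a 1 * q i \<in> ?S"
      unfolding q_def by (rule LeastI)
    then have "p < denumerant k a (i + a 1 * q i)"
      by (simp add: p_representable_def)
    also have "\<dots> \<le> denumerant k a (i + a 1 * q i + (t - q i) * a 1)"
      by (rule denumerant_add_generator[where a = a]) (use pos one in auto)
    also have "i + a 1 * q i + (t - q i) * a 1 = i + a 1 * t"
      using \<open>q i \<le> t\<close> by (metis add.assoc distrib_left le_add_diff_inverse mult.commute)
    finally show "i + a 1 * t \<in> ?S"
      by (simp add: p_representable_def)
  qed (simp add: q_def Least_le)
  show ?thesis
  proof
    have "n \<in> ?S \<longleftrightarrow> q (n mod a 1) \<le> n div a 1" for n
      using mem_iff[of "n mod a 1" "n div a 1"] pos[OF one] by simp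
    then show "p_gaps k a p = below_thresholds (a 1) q"
      by (auto simp: p_gaps_def below_thresholds_def not_less)
  next
    fix i
    assume i: "i < a 1"
    show "p_apery k a p i = i + a 1 * q i"
      unfolding p_apery_def
    proof (rule the_equality, intro conjI)
      show "(i + a 1 * q i) mod a 1 = i mod a 1"
        by (rule mod_mult_self2)
      show "i + a 1 * q i \<in> ?S"
        using mem_iff[OF i, of "q i"] by (rule iffD2) (rule order_refl)
      show "int (i + a 1 * q i) - int (a 1) \<notin> int ` ?S"
      proof
        assume "int (i + a 1 * q i) - int (a 1) \<in> int ` ?S"
        then obtain s where "s \<in> ?S" and int_s: "int (i + a 1 * q i) - int (a 1) = int s"
          by (rule imageE)
        have s_eq: "s + a 1 = i + a 1 * q i"
          using int_s by linarith
        \<comment> \<open>The quotient \<open>q i\<close> is positive because \<open>i < a 1\<close>, so \<open>s\<close> has quotient \<open>q i - 1\<close>.\<close>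
        then obtain r where r: "q i = Suc r"
          using i by (cases "q i") auto
        then have "s = i + a 1 * r"
          using s_eq by simp
        then show False
          using mem_iff[OF i, of r] r \<open>s \<in> ?S\<close> by simp
      qed
    next
      fix m
      assume m: "m mod a 1 = i mod a 1 \<and> m \<in> ?S \<and> int m - int (a 1) \<notin> int ` ?S"
      define t where "t = m div a 1"
      have m_eq: "m = i + a 1 * t"
        using m i mod_mult_div_eq[of m "a 1"] by (simp add: t_def)
      then have "q i \<le> t"
        using m mem_iff[OF i] by simp
      moreover have "\<not> q i < t"
      proof
        assume "q i < t"
        then obtain r where r: "t = Suc r" "q i \<le> r"
          by (cases t) auto
        then have "int (i + a 1 * r) \<in> int ` ?S"
          using mem_iff[OF i] by blast
        moreover have "int (i + a 1 * r) = int m - int (a 1)"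
          by (simp add: m_eq r algebra_simps)
        ultimately show False
          using m by simp
      qed
      ultimately show "m = i + a 1 * q i"
        by (simp add: m_eq)
    qed
  qed
qed

theorem corollary1:
  fixes k p :: nat and a :: "nat \<Rightarrow> nat"
  assumes "k \<ge> 2"
    and "\<And>i. i \<in> {1..k} \<Longrightarrow> a i > 0"
    and "Gcd (a ` {1..k}) = 1"
    and "a 1 = Min (a ` {1..k})"
  shows "p_frobenius k a p = int (Max (p_apery k a p ` {0..a 1 - 1})) - int (a 1) \<and>
         real (p_sylvester_number k a p) =
           1 / real (a 1) * (\<Sum>i = 0..a 1 - 1. real (p_apery k a p i)) - (real (a 1) - 1) / 2 \<and>
         real (p_sylvester_sum k a p) =
           1 / (2 * real (a 1)) * (\<Sum>i = 0..a 1 - 1. (real (p_apery k a p i))\<^sup>2)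
           - 1 / 2 * (\<Sum>i = 0..a 1 - 1. real (p_apery k a p i))
           + ((real (a 1))\<^sup>2 - 1) / 12"
proof -
  obtain q where gaps: "p_gaps k a p = below_thresholds (a 1) q"
    and apery: "\<And>i. i < a 1 \<Longrightarrow> p_apery k a p i = i + a 1 * q i"
    using ex_thresholds[OF assms(1-3)] by blast
  have "1 \<in> {1..k}"
    using assms(1) by simp
  then have pos: "a 1 > 0"
    by (rule assms(2))
  then have range: "{0..a 1 - 1} = {..<a 1}"
    by auto
  have image: "p_apery k a p ` {..<a 1} = (\<lambda>i. i + a 1 * q i) ` {..<a 1}"
    using apery by (intro image_cong) auto
  have sum: "(\<Sum>i<a 1. f (p_apery k a p i)) = (\<Sum>i<a 1. f (i + a 1 * q i))" for f :: "nat \<Rightarrow> real"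
    using apery by (intro sum.cong) auto
  have "p_sylvester_number k a p = card (below_thresholds (a 1) q)"
    unfolding p_sylvester_number_def gaps by simp
  then show ?thesis
    unfolding range image sum[of real] sum[of "\<lambda>m. (real m)\<^sup>2"] p_frobenius_def
      p_sylvester_sum_def gaps
    using Max_below_thresholds[OF pos, of q] card_below_thresholds[OF pos, of q]
      sum_below_thresholds_id[OF pos, of q] by metis
qed

end
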